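(* Let $G$ be a finite simple graph on $n \ge 2$ vertices with complement $\overline{G}$. For a graph $H$, let $n^+(H)$, $n^0(H)$, $n^-(H)$ denote the numbers of positive, zero and negative eigenvalues of the adjacency matrix of $H$, counted with multiplicity. Then \begin{align*} 1 &\le n^+(G) + n^+(\overline{G}) \le n + 1, \\ 0 &\le n^0(G) + n^0(\overline{G}) \le n, \\ n-1 &\le n^-(G) + n^-(\overline{G}). \end{align*}
   Context: $\overline{G}$ is the graph on the same vertex set in which two distinct vertices are adjacent if and only if they are not adjacent in $G$. *)

theory Defs
  imports "Graph_Theory.Pair_Digraph" "Jordan_Normal_Form.Char_Poly"
begin

text \<open>
  A finite simple graph is a \<^const>\<open>pair_graph\<close>: finitely many vertices, no loops, and an
  undirected edge \<open>uv\<close> represented by the two arcs \<open>(u, v)\<close> and \<open>(v, u)\<close>.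
\<close>

definition complement_graph :: "'a pair_pre_digraph \<Rightarrow> 'a pair_pre_digraph" where
  "complement_graph G =
     \<lparr> pverts = pverts G,
       parcs = {(u, v). u \<in> pverts G \<and> v \<in> pverts G \<and> u \<noteq> v \<and> (u, v) \<notin> parcs G} \<rparr>"

lemma pair_graph_complement_graph:
  assumes "pair_graph G"
  shows "pair_graph (complement_graph G)"
proof -
  interpret pair_graph G by (fact assms)
  have "finite {(u, v). u \<in> pverts G \<and> v \<in> pverts G \<and> u \<noteq> v \<and> (u, v) \<notin> parcs G}"
    by (rule finite_subset[of _ "pverts G \<times> pverts G"]) auto
  moreover have "sym (parcs G)"
    using pair_sym_arcs by (simp add: symmetric_def)
  ultimately show ?thesis
    by unfold_locales
      (auto simp: complement_graph_def symmetric_def intro!: symI dest: symD)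
qed

definition adjacency_mat_wrt :: "'a list \<Rightarrow> 'a pair_pre_digraph \<Rightarrow> real mat" where
  "adjacency_mat_wrt vs G =
     mat (length vs) (length vs) (\<lambda>(i, j). if (vs ! i, vs ! j) \<in> parcs G then 1 else 0)"

text \<open>
  Matrices are indexed by \<open>0, \<dots>, n - 1\<close>, so the vertices have to be enumerated. The enumeration is
  arbitrary; lemma \<open>char_poly_adjacency_mat\<close> below shows that the spectrum does not depend on it.
\<close>

definition vertex_list :: "'a pair_pre_digraph \<Rightarrow> 'a list" where
  "vertex_list G = (SOME vs. distinct vs \<and> set vs = pverts G)"

definition adjacency_mat :: "'a pair_pre_digraph \<Rightarrow> real mat" where
  "adjacency_mat G = adjacency_mat_wrt (vertex_list G) G"

text \<open>
  The number of real eigenvalues satisfying \<open>P\<close>, each counted with its multiplicity as a root of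
  the characteristic polynomial. Adjacency matrices of graphs are real symmetric, so all their
  eigenvalues are real.
\<close>

definition num_eigenvalues :: "(real \<Rightarrow> bool) \<Rightarrow> real mat \<Rightarrow> nat" where
  "num_eigenvalues P A = (\<Sum>x | eigenvalue A x \<and> P x. order x (char_poly A))"

definition n_pos :: "'a pair_pre_digraph \<Rightarrow> nat" where
  "n_pos G = num_eigenvalues (\<lambda>x. x > 0) (adjacency_mat G)"

definition n_zero :: "'a pair_pre_digraph \<Rightarrow> nat" where
  "n_zero G = num_eigenvalues (\<lambda>x. x = 0) (adjacency_mat G)"

definition n_neg :: "'a pair_pre_digraph \<Rightarrow> nat" where
  "n_neg G = num_eigenvalues (\<lambda>x. x < 0) (adjacency_mat G)"

lemma finite_eigenvalues:
  assumes "(A :: real mat) \<in> carrier_mat n n"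
  shows "finite {x. eigenvalue A x}"
proof -
  have "char_poly A \<noteq> 0"
    using degree_monic_char_poly[OF assms] by auto
  then show ?thesis
    using poly_roots_finite by (simp add: eigenvalue_root_char_poly[OF assms])
qed

lemma vertex_list:
  assumes "finite (pverts G)"
  shows "distinct (vertex_list G)" "set (vertex_list G) = pverts G"
    "length (vertex_list G) = card (pverts G)"
proof -
  have "\<exists>vs. distinct vs \<and> set vs = pverts G"
    using finite_distinct_list[OF assms] by blast
  then have *: "distinct (vertex_list G) \<and> set (vertex_list G) = pverts G"
    unfolding vertex_list_def by (rule someI_ex)
  then show "distinct (vertex_list G)" "set (vertex_list G) = pverts G"
    "length (vertex_list G) = card (pverts G)"
    using distinct_card[of "vertex_list G"] by auto
qed

lemma similar_adjacency_mat_wrt: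
  assumes vs: "distinct vs" "set vs = V" and ws: "distinct ws" "set ws = V"
  shows "similar_mat (adjacency_mat_wrt vs G) (adjacency_mat_wrt ws G)"
proof -
  define n where "n = length vs"
  have n: "length vs = n" "length ws = n"
    using vs ws distinct_card unfolding n_def by metis+
  have "\<forall>i<n. \<exists>k<n. vs ! i = ws ! k"
    using vs ws n by (metis in_set_conv_nth)
  then obtain f where f: "\<And>i. i < n \<Longrightarrow> f i < n" "\<And>i. i < n \<Longrightarrow> vs ! i = ws ! f i"
    by metis
  have inj: "f i = f j \<longleftrightarrow> i = j" if "i < n" "j < n" for i j
    using that f vs(1) n by (metis nth_eq_iff_index_eq)
  define P :: "real mat" where "P = mat n n (\<lambda>(i, k). if f i = k then 1 else 0)"
  define Q :: "real mat" where "Q = mat n n (\<lambda>(k, j). if f j = k then 1 else 0)"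
  let ?A = "adjacency_mat_wrt vs G" and ?B = "adjacency_mat_wrt ws G"
  have carr: "P \<in> carrier_mat n n" "Q \<in> carrier_mat n n" "?A \<in> carrier_mat n n" "?B \<in> carrier_mat n n"
    by (auto simp: P_def Q_def adjacency_mat_wrt_def n)
  have PQ: "P * Q = 1\<^sub>m n"
    by (rule eq_matI) (auto simp: P_def Q_def scalar_prod_def f inj
        if_distrib[of "\<lambda>x. x * _"] cong: if_cong)
  have QP: "Q * P = 1\<^sub>m n"
    using mat_mult_left_right_inverse[OF carr(1,2) PQ] .
  have PB: "P * ?B = mat n n (\<lambda>(i, j). ?B $$ (f i, j))"
    using f by (intro eq_matI)
      (auto simp: P_def adjacency_mat_wrt_def n scalar_prod_def if_distrib[of "\<lambda>x. x * _"] cong: if_cong)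
  have "P * ?B * Q = ?A"
    unfolding PB using f by (intro eq_matI)
      (auto simp: Q_def adjacency_mat_wrt_def n scalar_prod_def if_distrib[of "\<lambda>x. _ * x"] cong: if_cong)
  then show ?thesis
    using carr PQ QP by (intro similar_matI[of _ _ P Q n]) auto
qed

lemma char_poly_adjacency_mat:
  assumes "finite (pverts G)" "distinct vs" "set vs = pverts G"
  shows "char_poly (adjacency_mat G) = char_poly (adjacency_mat_wrt vs G)"
  unfolding adjacency_mat_def
  by (intro char_poly_similar similar_adjacency_mat_wrt[OF vertex_list(1,2)[OF assms(1)] assms(2,3)])

end

theory Submission
  imports Defs
begin

text \<open>
  The adjacency matrices of a graph and its complement satisfy \<open>A + B = J - I\<close>, so the sum of their
  quadratic forms at \<open>x\<close> is \<open>(\<Sum>i. x\<^sub>i)\<^sup>2 - |x|\<^sup>2\<close>. At the all-ones vector this is positive, hence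
  \<open>A\<close> and \<open>B\<close> are not both negative semidefinite: one of them has a positive eigenvalue. If \<open>A\<close> and
  \<open>B\<close> together had fewer than \<open>n - 1\<close> negative eigenvalues, some nonzero \<open>x\<close> would be orthogonal to
  the corresponding eigenvectors and to the all-ones vector; both forms would be nonnegative at \<open>x\<close>,
  but their sum is \<open>- |x|\<^sup>2\<close>. The upper bounds follow, since each matrix has \<open>n\<close> real eigenvalues.
\<close>

section \<open>Diagonalisation of real symmetric matrices\<close>

text \<open>Over the complex numbers the characteristic polynomial splits, so some eigenvalue
  \<open>a\<close> exists. Moving the real symmetric matrix across the Hermitian product of an
  eigenvector with itself gives \<open>a = cnj a\<close>, so \<open>a\<close> is real and already a
  root of the real characteristic polynomial.\<close>

lemma symmetric_real_mat_has_eigenvalue: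
  fixes A :: "real mat"
  assumes A: "A \<in> carrier_mat n n" and sym: "transpose_mat A = A" and n: "0 < n"
  shows "\<exists>e. eigenvalue A e"
proof -
  let ?C = "map_mat complex_of_real A"
  have C: "?C \<in> carrier_mat n n"
    using A by simp
  have symC: "transpose_mat ?C = ?C"
    using sym by (metis map_mat_transpose)
  obtain as where as: "char_poly ?C = (\<Prod>a\<leftarrow>as. [:- a, 1:])" "length as = n"
    using char_poly_factorized[OF C] by blast
  then obtain a as' where "as = a # as'"
    using n by (cases as) auto
  with as have root: "poly (char_poly ?C) a = 0"
    by simp
  then have "eigenvalue ?C a"
    using eigenvalue_root_char_poly[OF C] by simp
  then obtain v where v: "v \<in> carrier_vec n" "v \<noteq> 0\<^sub>v n" "?C *\<^sub>v v = a \<cdot>\<^sub>v v"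
    using C by (auto simp: eigenvalue_def eigenvector_def)
  have cv: "conjugate v \<in> carrier_vec n"
    using v by simp
  have conj: "?C *\<^sub>v conjugate v = conjugate (?C *\<^sub>v v)"
    using A v(1) by (intro eq_vecI) (auto simp: scalar_prod_def)
  have "a * (v \<bullet>c v) = (transpose_mat ?C *\<^sub>v v) \<bullet>c v"
    using v cv by (simp add: symC)
  also have "\<dots> = v \<bullet> (?C *\<^sub>v conjugate v)"
    using transpose_vec_mult_scalar[OF C cv v(1)] .
  also have "\<dots> = cnj a * (v \<bullet>c v)"
    using v cv by (simp add: conj conjugate_smult_vec)
  finally have "a = cnj a"
    using v by simp
  then have "a = complex_of_real (Re a)"
    by (metis Reals_cnj_iff of_real_Re)
  then have "complex_of_real (poly (char_poly A) (Re a)) = 0"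
    using root by (metis of_real_hom.char_poly_hom[OF A] of_real_hom.poly_map_poly)
  then show ?thesis
    using eigenvalue_root_char_poly[OF A] by auto
qed

text \<open>A reflection completes a unit vector to an orthonormal basis explicitly. Being symmetric
  and its own inverse, it serves on both sides of a conjugation.\<close>

lemma ex_orthogonal_mat_first_col:
  fixes v :: "real vec"
  assumes v: "v \<in> carrier_vec n" and vv: "v \<bullet> v = 1" and n: "0 < n"
  shows "\<exists>W \<in> carrier_mat n n. transpose_mat W = W \<and> W * W = 1\<^sub>m n \<and> col W 0 = v"
proof -
  define u where "u = (\<lambda>i. v $ i - (if i = 0 then 1 else 0))"
  define s where "s = (\<Sum>k = 0..<n. u k * u k)"
  \<comment> \<open>The Householder reflection exchanging \<open>v\<close> and the first unit vector; if the two coincide,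
    then \<open>s = 0\<close>, so \<open>c = 2 / 0 = 0\<close> and \<open>W\<close> is the identity.\<close>
  define c where "c = 2 / s"
  define W where "W = mat n n (\<lambda>(i, j). (if i = j then 1 else 0) - c * u i * u j)"
  have W: "W \<in> carrier_mat n n"
    by (simp add: W_def)
  have sumv: "(\<Sum>k = 0..<n. v $ k * v $ k) = 1"
    using v vv by (simp add: scalar_prod_def)
  have "s = (\<Sum>k = 0..<n. v $ k * v $ k - (if k = 0 then 2 * v $ 0 - 1 else 0))"
    unfolding s_def u_def by (intro sum.cong) (auto simp: algebra_simps)
  also have "\<dots> = 2 - 2 * v $ 0"
    using n by (simp add: sum_subtractf sumv)
  \<comment> \<open>Since \<open>v\<close> is a unit vector, its squared distance to the first unit
    vector is \<open>2 - 2 * v $ 0\<close>. For nonzero \<open>s\<close> this makes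
    \<open>c * u 0 = -1\<close>, which is what puts \<open>v\<close> into column 0.\<close>
  finally have s: "s = - 2 * u 0"
    by (simp add: u_def)
  have u_eq_0: "u i = 0" if "s = 0" "i < n" for i
    using that unfolding s_def by (subst (asm) sum_nonneg_eq_0_iff) auto
  have WW: "W * W = 1\<^sub>m n"
  proof (rule eq_matI)
    fix i j assume "i < dim_row (1\<^sub>m n :: real mat)" "j < dim_col (1\<^sub>m n :: real mat)"
    then have ij: "i < n" "j < n"
      by auto
    have "(W * W) $$ (i, j) = (\<Sum>k = 0..<n. ((if i = k then 1 else 0) - c * u i * u k)
        * ((if k = j then 1 else 0) - c * u k * u j))"
      using ij by (simp add: W_def scalar_prod_def)
    also have "\<dots> = (\<Sum>k = 0..<n. (if k = i then (if i = j then 1 else 0) - c * u i * u j else 0)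
        - (if k = j then c * u i * u j else 0) + c * c * u i * u j * (u k * u k))"
      by (intro sum.cong) (auto simp: algebra_simps)
    also have "\<dots> = (if i = j then 1 else 0) - 2 * c * u i * u j + c * c * u i * u j * s"
      using ij by (simp add: sum.distrib sum_subtractf sum_distrib_left[symmetric] s_def)
    \<comment> \<open>The two correction terms cancel because \<open>c * c * s = 2 * c\<close>, also
      in the degenerate case, where \<open>c = 0\<close>.\<close>
    also have "\<dots> = (if i = j then 1 else 0)"
      by (cases "s = 0") (auto simp: c_def)
    finally show "(W * W) $$ (i, j) = 1\<^sub>m n $$ (i, j)"
      using ij by simp
  qed (auto simp: W_def)
  have "col W 0 = v"
  proof (rule eq_vecI)
    fix i assume "i < dim_vec v"
    then have i: "i < n"
      using v by simp
    have "c * u i * u 0 = - u i"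
      using s u_eq_0[of i] i by (cases "s = 0") (auto simp: c_def field_simps)
    then show "col W 0 $ i = v $ i"
      using i n by (auto simp: W_def u_def)
  qed (use v W in auto)
  moreover have "transpose_mat W = W"
    by (intro eq_matI) (auto simp: W_def)
  ultimately show ?thesis
    using W WW by blast
qed

text \<open>Induction on the dimension: conjugating by a reflection whose first column is a unit
  eigenvector splits off a 1 by 1 block, and the induction hypothesis diagonalises the remaining
  symmetric block.\<close>

theorem symmetric_real_mat_diagonalizable:
  fixes A :: "real mat"
  assumes "A \<in> carrier_mat n n" and "transpose_mat A = A"
  shows "\<exists>P es. P \<in> carrier_mat n n \<and> transpose_mat P * P = 1\<^sub>m n \<and> length es = n
    \<and> A = P * mat_diag n (\<lambda>i. es ! i) * transpose_mat P"
  using assms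
proof (induction n arbitrary: A)
  case 0
  then show ?case
    by (intro exI[of _ "1\<^sub>m 0"] exI[of _ "[]"]) auto
next
  case (Suc n A)
  note A = Suc.prems(1) and sym = Suc.prems(2)
  obtain e v0 where v0: "v0 \<in> carrier_vec (Suc n)" "v0 \<noteq> 0\<^sub>v (Suc n)" "A *\<^sub>v v0 = e \<cdot>\<^sub>v v0"
    using symmetric_real_mat_has_eigenvalue[OF A sym] A
    by (auto simp: eigenvalue_def eigenvector_def)
  define v where "v = (1 / sqrt (v0 \<bullet> v0)) \<cdot>\<^sub>v v0"
  have v: "v \<in> carrier_vec (Suc n)"
    using v0 by (simp add: v_def)
  have "v0 \<bullet> v0 > 0"
    using conjugate_square_greater_0_vec[OF v0(1)] v0(2) by simp
  then have vv: "v \<bullet> v = 1"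
    using v0(1) by (simp add: v_def field_simps)
  have Av: "A *\<^sub>v v = e \<cdot>\<^sub>v v"
    using v0 A by (simp add: v_def mult_mat_vec smult_smult_assoc mult.commute)
  obtain W where W: "W \<in> carrier_mat (Suc n) (Suc n)" and symW: "transpose_mat W = W"
    and WW: "W * W = 1\<^sub>m (Suc n)" and colW: "col W 0 = v"
    using ex_orthogonal_mat_first_col[OF v vv] by auto
  note assoc = assoc_mult_mat[of _ "Suc n" "Suc n" _ "Suc n" _ "Suc n"]
    and carrier = mult_carrier_mat[of _ "Suc n" "Suc n" _ "Suc n"]
    and transpose = transpose_mult[of _ "Suc n" "Suc n" _ "Suc n"]
  define A' where "A' = W * A * W"
  have A': "A' \<in> carrier_mat (Suc n) (Suc n)"
    using W A by (auto simp: A'_def)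
  have symA': "transpose_mat A' = A'"
  proof -
    have "transpose_mat A' = W * (A * W)"
      unfolding A'_def using W A by (simp add: transpose carrier assoc sym symW)
    also have "\<dots> = A'"
      unfolding A'_def by (rule assoc_mult_mat[symmetric, OF W A W])
    finally show ?thesis .
  qed
  have A_eq: "A = W * A' * W"
  proof -
    have "W * A' * W = (W * W) * A * (W * W)"
      unfolding A'_def using W A by (simp add: assoc carrier)
    then show ?thesis
      using A by (simp add: WW)
  qed
  \<comment> \<open>\<open>W\<close> sends the first unit vector to \<open>v\<close>,
    \<open>A\<close> scales \<open>v\<close> by \<open>e\<close>, and \<open>W\<close> sends
    \<open>v\<close> back. Symmetry then clears the first row as well.\<close>
  have col0: "A' $$ (i, 0) = (if i = 0 then e else 0)" if i: "i < Suc n" for i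
  proof -
    have "col A' 0 = W *\<^sub>v (A *\<^sub>v col W 0)"
      unfolding A'_def using W A by (simp add: assoc carrier col_mult2[of _ "Suc n" "Suc n" _ "Suc n"] del: col_mult)
    also have "\<dots> = e \<cdot>\<^sub>v (W *\<^sub>v col W 0)"
      using W v by (simp add: colW Av mult_mat_vec)
    also have "W *\<^sub>v col W 0 = col (W * W) 0"
      by (rule col_mult2[OF W W, symmetric]) simp
    also have "\<dots> = unit_vec (Suc n) 0"
      by (simp add: WW)
    finally have "col A' 0 $ i = (e \<cdot>\<^sub>v unit_vec (Suc n) 0) $ i"
      by simp
    then show ?thesis
      using i A' by auto
  qed
  have row0: "A' $$ (0, i) = (if i = 0 then e else 0)" if i: "i < Suc n" for i
    using col0[OF i] A' i arg_cong[OF symA', of "\<lambda>M. M $$ (0, i)"] by auto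
  define A3 where "A3 = mat n n (\<lambda>(i, j). A' $$ (Suc i, Suc j))"
  have A3: "A3 \<in> carrier_mat n n"
    by (simp add: A3_def)
  have A'_entry: "A' $$ (i, j) = A' $$ (j, i)" if "i < Suc n" "j < Suc n" for i j
    using that A' symA' by (metis carrier_matD index_transpose_mat(1))
  have symA3: "transpose_mat A3 = A3"
    by (intro eq_matI) (auto simp: A3_def intro: A'_entry)
  have A'_block: "A' = four_block_mat (mat 1 1 (\<lambda>_. e)) (0\<^sub>m 1 n) (0\<^sub>m n 1) A3"
    using A' by (intro eq_matI) (auto simp: A3_def row0 col0)
  obtain P es where P: "P \<in> carrier_mat n n" and PP: "transpose_mat P * P = 1\<^sub>m n"
    and es: "length es = n" and A3_eq: "A3 = P * mat_diag n (\<lambda>i. es ! i) * transpose_mat P"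
    using Suc.IH[OF A3 symA3] by blast
  \<comment> \<open>Extending \<open>P\<close> by a corner entry 1 keeps it orthogonal and fixes the
    block that was split off, so \<open>B\<close> diagonalises \<open>A'\<close> and
    \<open>W * B\<close> diagonalises \<open>A\<close>.\<close>
  define B where "B = four_block_mat (1\<^sub>m 1) (0\<^sub>m 1 n) (0\<^sub>m n 1) P"
  define D where "D = mat_diag (Suc n) (\<lambda>i. (e # es) ! i)"
  have carr: "1\<^sub>m 1 \<in> carrier_mat 1 1" "0\<^sub>m 1 n \<in> carrier_mat 1 n" "0\<^sub>m n 1 \<in> carrier_mat n 1"
    by auto
  have B: "B \<in> carrier_mat (Suc n) (Suc n)" and D: "D \<in> carrier_mat (Suc n) (Suc n)"
    using P by (auto simp: B_def D_def)
  have Pt: "transpose_mat P \<in> carrier_mat n n"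
    using P by simp
  have Bt: "transpose_mat B = four_block_mat (1\<^sub>m 1) (0\<^sub>m 1 n) (0\<^sub>m n 1) (transpose_mat P)"
    unfolding B_def by (subst transpose_four_block_mat[OF carr P]) simp
  have D_block: "D = four_block_mat (mat 1 1 (\<lambda>_. e)) (0\<^sub>m 1 n) (0\<^sub>m n 1) (mat_diag n (\<lambda>i. es ! i))"
    by (intro eq_matI) (auto simp: D_def mat_diag_def nth_Cons')
  have BB: "transpose_mat B * B = 1\<^sub>m (Suc n)"
    unfolding Bt unfolding B_def
    by (subst mult_four_block_mat[OF carr Pt carr P]) (use P PP in \<open>auto intro!: eq_matI\<close>)
  have BD: "B * D = four_block_mat (mat 1 1 (\<lambda>_. e)) (0\<^sub>m 1 n) (0\<^sub>m n 1) (P * mat_diag n (\<lambda>i. es ! i))"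
    unfolding B_def D_block using P
    by (subst mult_four_block_mat[OF carr P, of _ 1 _ n]) (auto simp: left_mult_zero_mat[OF mat_diag_dim])
  have PD: "P * mat_diag n (\<lambda>i. es ! i) \<in> carrier_mat n n"
    using P by (rule mult_carrier_mat) simp
  have BDB: "B * D * transpose_mat B = A'"
    unfolding BD Bt A'_block A3_eq using P
    by (subst mult_four_block_mat[OF _ carr(2,3) PD carr Pt])
      (auto simp: right_mult_zero_mat[OF PD] left_add_zero_mat[OF mult_carrier_mat[OF PD Pt]])
  define Q where "Q = W * B"
  have Q: "Q \<in> carrier_mat (Suc n) (Suc n)"
    using W B by (simp add: Q_def)
  have Qt: "transpose_mat Q = transpose_mat B * W"
    unfolding Q_def using W B by (simp add: transpose symW)
  have Bt': "transpose_mat B \<in> carrier_mat (Suc n) (Suc n)"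
    using B by simp
  have "transpose_mat Q * Q = transpose_mat B * (W * W) * B"
    unfolding Qt unfolding Q_def using W B Bt' by (simp add: assoc carrier)
  also have "\<dots> = 1\<^sub>m (Suc n)"
    using Bt' by (simp add: WW BB)
  finally have QQ: "transpose_mat Q * Q = 1\<^sub>m (Suc n)" .
  have "Q * D * transpose_mat Q = W * (B * D * transpose_mat B) * W"
    unfolding Qt unfolding Q_def using W B Bt' D by (simp add: assoc carrier)
  then have "A = Q * D * transpose_mat Q"
    by (simp add: BDB A_eq[symmetric])
  then show ?case
    using Q QQ es by (intro exI[of _ Q] exI[of _ "e # es"]) (simp add: D_def)
qed

section \<open>Inertia and quadratic forms\<close>

text \<open>The order of a root of a product of linear factors is the number of times it occurs in
  the list, so counting with multiplicity becomes counting list positions.\<close>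

lemma num_eigenvalues_eq_length_filter:
  assumes A: "A \<in> carrier_mat n n" and cp: "char_poly A = (\<Prod>e\<leftarrow>es. [:- e, 1:])"
  shows "num_eigenvalues Q A = length (filter Q es)"
proof -
  have ord: "order x (char_poly A) = count_list es x" for x
    unfolding cp
  proof (induction es)
    case (Cons a es)
    have "(\<Prod>e\<leftarrow>a # es. [:- e, 1:]) \<noteq> 0"
      by (subst prod_list_zero_iff) auto
    then show ?case
      using Cons order_mult[of "[:- a, 1:]" "\<Prod>e\<leftarrow>es. [:- e, 1:]" x]
      by (simp add: order_linear' del: mult_pCons_left)
  qed simp
  have "{x. eigenvalue A x \<and> Q x} = set (filter Q es)"
    unfolding eigenvalue_root_char_poly[OF A] cp
    by (induction es) (auto simp: poly_prod_list)
  then have "num_eigenvalues Q A = (\<Sum>x\<in>set (filter Q es). count_list es x)"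
    by (simp add: num_eigenvalues_def ord)
  also have "\<dots> = (\<Sum>x\<in>set (filter Q es). count_list (filter Q es) x)"
    by (intro sum.cong) (auto simp: count_list_eq_length_filter intro: arg_cong[of _ _ length] filter_cong)
  also have "\<dots> = length (filter Q es)"
    by (rule sum_count_set) auto
  finally show ?thesis .
qed

text \<open>Here \<open>p i\<close> is the \<open>i\<close>-th column of the diagonalising matrix,
  so \<open>p i \<bullet> x\<close> is a coordinate of \<open>x\<close> in an orthonormal
  eigenbasis. The same list \<open>es\<close> supplies the eigenvalue counts and the coefficients of
  the form, which links inertia to signs of the form.\<close>

lemma symmetric_real_mat_quadratic_form:
  fixes A :: "real mat"
  assumes A: "A \<in> carrier_mat n n" and sym: "transpose_mat A = A"
  obtains es p where "length es = n"
    and "\<And>Q. num_eigenvalues Q A = length (filter Q es)"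
    and "\<And>i. i < n \<Longrightarrow> p i \<in> carrier_vec n"
    and "\<And>x. x \<in> carrier_vec n \<Longrightarrow> x \<bullet> (A *\<^sub>v x) = (\<Sum>i<n. es ! i * (p i \<bullet> x)\<^sup>2)"
proof -
  obtain P es where P: "P \<in> carrier_mat n n" and PP: "transpose_mat P * P = 1\<^sub>m n"
    and es: "length es = n" and A_eq: "A = P * mat_diag n (\<lambda>i. es ! i) * transpose_mat P"
    using symmetric_real_mat_diagonalizable[OF A sym] by blast
  let ?D = "mat_diag n (\<lambda>i. es ! i)"
  have Pt: "transpose_mat P \<in> carrier_mat n n"
    using P by simp
  \<comment> \<open>For square matrices a left inverse is also a right inverse; similarity needs
    both.\<close>
  have "P * transpose_mat P = 1\<^sub>m n"
    using mat_mult_left_right_inverse[OF Pt P PP] .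
  then have "similar_mat A ?D"
    using A P PP A_eq by (intro similar_matI[of _ _ P "transpose_mat P" n]) auto
  then have "char_poly A = char_poly ?D"
    by (rule char_poly_similar)
  also have "\<dots> = (\<Prod>e\<leftarrow>diag_mat ?D. [:- e, 1:])"
    by (rule char_poly_upper_triangular[of _ n]) (auto simp: mat_diag_def)
  also have "diag_mat ?D = es"
    by (intro nth_equalityI) (auto simp: diag_mat_def mat_diag_def es)
  finally have cp: "char_poly A = (\<Prod>e\<leftarrow>es. [:- e, 1:])" .
  show thesis
  proof (rule that[OF es num_eigenvalues_eq_length_filter[OF A cp]])
    show "col P i \<in> carrier_vec n" if "i < n" for i
      using P that by simp
    fix x :: "real vec" assume x: "x \<in> carrier_vec n"
    let ?y = "transpose_mat P *\<^sub>v x"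
    have y: "?y \<in> carrier_vec n"
      using Pt x by simp
    have "x \<bullet> (A *\<^sub>v x) = x \<bullet> (P *\<^sub>v (?D *\<^sub>v ?y))"
      unfolding A_eq using P Pt x
      by (simp add: assoc_mult_mat_vec[of _ n n _ n])
    also have "\<dots> = ?y \<bullet> (?D *\<^sub>v ?y)"
      by (rule transpose_vec_mult_scalar[OF P mult_mat_vec_carrier[OF mat_diag_dim y] x, symmetric])
    also have "?D *\<^sub>v ?y = vec n (\<lambda>i. es ! i * ?y $ i)"
      using y P by (intro eq_vecI)
        (auto simp: mat_diag_def scalar_prod_def if_distrib[of "\<lambda>x. x * _"] cong: if_cong)
    also have "?y \<bullet> vec n (\<lambda>i. es ! i * ?y $ i) = (\<Sum>i<n. es ! i * (col P i \<bullet> x)\<^sup>2)"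
      using P unfolding scalar_prod_def[of ?y]
      by (auto simp: lessThan_atLeast0 power2_eq_square intro!: sum.cong)
    finally show "x \<bullet> (A *\<^sub>v x) = (\<Sum>i<n. es ! i * (col P i \<bullet> x)\<^sup>2)" .
  qed
qed

lemma num_eigenvalues_trichotomy:
  fixes A :: "real mat"
  assumes "A \<in> carrier_mat n n" and "transpose_mat A = A"
  shows "num_eigenvalues (\<lambda>x. x > 0) A + num_eigenvalues (\<lambda>x. x = 0) A
    + num_eigenvalues (\<lambda>x. x < 0) A = n"
proof -
  obtain es where es: "length es = n" "\<And>Q. num_eigenvalues Q A = length (filter Q es)"
    using symmetric_real_mat_quadratic_form[OF assms] by metis
  have "length (filter (\<lambda>x. x > 0) es) + length (filter (\<lambda>x. x = 0) es)
    + length (filter (\<lambda>x. x < 0) es) = length es"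
    by (induction es) auto
  then show ?thesis
    using es by simp
qed

lemma quadratic_form_nonpos:
  fixes A :: "real mat"
  assumes A: "A \<in> carrier_mat n n" "transpose_mat A = A"
    and pos: "num_eigenvalues (\<lambda>x. x > 0) A = 0" and x: "x \<in> carrier_vec n"
  shows "x \<bullet> (A *\<^sub>v x) \<le> 0"
proof -
  obtain es p where es: "length es = n" "\<And>Q. num_eigenvalues Q A = length (filter Q es)"
    and q: "\<And>x. x \<in> carrier_vec n \<Longrightarrow> x \<bullet> (A *\<^sub>v x) = (\<Sum>i<n. es ! i * (p i \<bullet> x)\<^sup>2)"
    by (rule symmetric_real_mat_quadratic_form[OF A]) blast
  have "es ! i \<le> 0" if "i < n" for i
    using pos es that by (auto simp: filter_empty_conv not_less)
  then show ?thesis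
    unfolding q[OF x] by (auto intro!: sum_nonpos mult_nonpos_nonneg)
qed

text \<open>Orthogonality to the eigenvectors of negative eigenvalues removes every term of the
  weighted sum of squares that has a negative coefficient.\<close>

lemma quadratic_form_nonneg_on_annihilator:
  fixes A :: "real mat"
  assumes A: "A \<in> carrier_mat n n" "transpose_mat A = A"
  obtains fs where "length fs = num_eigenvalues (\<lambda>x. x < 0) A" "set fs \<subseteq> carrier_vec n"
    "\<And>x. x \<in> carrier_vec n \<Longrightarrow> (\<And>f. f \<in> set fs \<Longrightarrow> f \<bullet> x = 0) \<Longrightarrow> 0 \<le> x \<bullet> (A *\<^sub>v x)"
proof -
  obtain es p where es: "length es = n" "\<And>Q. num_eigenvalues Q A = length (filter Q es)"
    and p: "\<And>i. i < n \<Longrightarrow> p i \<in> carrier_vec n"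
    and q: "\<And>x. x \<in> carrier_vec n \<Longrightarrow> x \<bullet> (A *\<^sub>v x) = (\<Sum>i<n. es ! i * (p i \<bullet> x)\<^sup>2)"
    by (rule symmetric_real_mat_quadratic_form[OF A]) blast
  \<comment> \<open>Selecting indices rather than values gives a repeated eigenvalue one vector per
    occurrence, so the length agrees with the count by multiplicity.\<close>
  define fs where "fs = map p (filter (\<lambda>i. es ! i < 0) [0..<n])"
  have "filter (\<lambda>x. x < 0) es = map ((!) es) (filter (\<lambda>i. es ! i < 0) [0..<n])"
    using filter_map[of "\<lambda>x. x < 0" "(!) es" "[0..<n]"] map_nth[of es] es(1) by (simp add: o_def)
  then have "length fs = num_eigenvalues (\<lambda>x. x < 0) A"
    by (simp add: es(2) fs_def)
  moreover have "set fs \<subseteq> carrier_vec n"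
    using p by (auto simp: fs_def)
  moreover have "0 \<le> x \<bullet> (A *\<^sub>v x)"
    if x: "x \<in> carrier_vec n" and ann: "\<And>f. f \<in> set fs \<Longrightarrow> f \<bullet> x = 0" for x
    unfolding q[OF x]
  proof (rule sum_nonneg)
    fix i assume "i \<in> {..<n}"
    then show "0 \<le> es ! i * (p i \<bullet> x)\<^sup>2"
      using ann[of "p i"] by (cases "es ! i < 0") (auto simp: fs_def)
  qed
  ultimately show thesis
    by (rule that)
qed

text \<open>Fewer than \<open>n\<close> homogeneous linear equations in \<open>n\<close> unknowns
  have a nontrivial solution. Padding the system with zero rows makes it square, so that a vanishing
  determinant yields the solution.\<close>

lemma ex_nonzero_annihilated_vec:
  fixes fs :: "'a :: field vec list"
  assumes fs: "set fs \<subseteq> carrier_vec n" and len: "length fs < n"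
  obtains x where "x \<in> carrier_vec n" "x \<noteq> 0\<^sub>v n" "\<And>f. f \<in> set fs \<Longrightarrow> f \<bullet> x = 0"
proof -
  define M where "M = mat n n (\<lambda>(i, j). if i < length fs then fs ! i $ j else 0)"
  have M: "M \<in> carrier_mat n n"
    by (simp add: M_def)
  \<comment> \<open>Row \<open>n - 1\<close> of \<open>M\<close> is padding because
    \<open>length fs < n\<close>; hence the transpose kills the last unit vector and is
    singular.\<close>
  have "transpose_mat M *\<^sub>v unit_vec n (n - 1) = 0\<^sub>v n"
    using len by (intro eq_vecI) (auto simp: M_def)
  moreover have "unit_vec n (n - 1) \<noteq> (0\<^sub>v n :: 'a vec)"
    using len by (simp add: unit_vec_nonzero)
  ultimately have "det (transpose_mat M) = 0"
    using M by (subst det_0_iff_vec_prod_zero[of _ n]) (auto intro!: exI[of _ "unit_vec n (n - 1)"])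
  then have "det M = 0"
    using det_transpose[OF M] by simp
  then obtain x where x: "x \<in> carrier_vec n" "x \<noteq> 0\<^sub>v n" "M *\<^sub>v x = 0\<^sub>v n"
    using det_0_iff_vec_prod_zero[OF M] by blast
  have "f \<bullet> x = 0" if f: "f \<in> set fs" for f
  proof -
    obtain i where i: "i < length fs" "f = fs ! i"
      using f by (auto simp: in_set_conv_nth)
    have "f \<in> carrier_vec n"
      using f fs by blast
    then have "row M i = f"
      using i len by (intro eq_vecI) (auto simp: M_def)
    then show ?thesis
      using arg_cong[OF x(3), of "\<lambda>v. v $ i"] i len M by simp
  qed
  with x show thesis
    using that by blast
qed

section \<open>The adjacency matrices of a graph and its complement\<close>

lemma adjacency_mat_carrier:
  assumes "finite (pverts G)"
  shows "adjacency_mat G \<in> carrier_mat (card (pverts G)) (card (pverts G))"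
  using vertex_list(3)[OF assms] by (simp add: adjacency_mat_def adjacency_mat_wrt_def)

lemma transpose_adjacency_mat:
  assumes "pair_graph G"
  shows "transpose_mat (adjacency_mat G) = adjacency_mat G"
proof -
  interpret pair_graph G by (fact assms)
  have "sym (parcs G)"
    using pair_sym_arcs by (simp add: symmetric_def)
  then show ?thesis
    by (intro eq_matI) (auto simp: adjacency_mat_def adjacency_mat_wrt_def dest: symD)
qed

lemma adjacency_mat_add_complement:
  assumes "pair_graph G"
  shows "adjacency_mat G + adjacency_mat (complement_graph G)
    = mat (card (pverts G)) (card (pverts G)) (\<lambda>(i, j). if i = j then 0 else 1)"
proof -
  interpret pair_graph G by (fact assms)
  \<comment> \<open>The choice in \<open>vertex_list\<close> depends only on the vertex set, so both
    matrices use the same enumeration and may be added entrywise.\<close>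
  have vs: "vertex_list (complement_graph G) = vertex_list G"
    by (simp add: vertex_list_def complement_graph_def)
  have arcs: "(u, v) \<in> parcs (complement_graph G)
      \<longleftrightarrow> u \<in> pverts G \<and> v \<in> pverts G \<and> u \<noteq> v \<and> (u, v) \<notin> parcs G" for u v
    by (simp add: complement_graph_def)
  note vl = vertex_list[OF pair_finite_verts]
  have "vertex_list G ! i \<in> pverts G" if "i < card (pverts G)" for i
    using that vl by (metis nth_mem)
  moreover have "vertex_list G ! i = vertex_list G ! j \<longleftrightarrow> i = j"
    if "i < card (pverts G)" "j < card (pverts G)" for i j
    using that vl by (simp add: nth_eq_iff_index_eq)
  ultimately show ?thesis
    by (intro eq_matI)
      (auto simp: adjacency_mat_def adjacency_mat_wrt_def vs arcs vl(3)
        dest: pair_no_loops)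
qed

lemma adjacency_quadratic_form_add_complement:
  assumes G: "pair_graph G" and n: "n = card (pverts G)" and x: "x \<in> carrier_vec n"
  shows "x \<bullet> (adjacency_mat G *\<^sub>v x) + x \<bullet> (adjacency_mat (complement_graph G) *\<^sub>v x)
    = (\<Sum>i<n. x $ i)\<^sup>2 - x \<bullet> x"
proof -
  let ?A = "adjacency_mat G" and ?B = "adjacency_mat (complement_graph G)"
  interpret pair_graph G by (fact G)
  have A: "?A \<in> carrier_mat n n" and B: "?B \<in> carrier_mat n n"
    using adjacency_mat_carrier[of G] adjacency_mat_carrier[of "complement_graph G"] n
    by (simp_all add: complement_graph_def)
  have "x \<bullet> (?A *\<^sub>v x) + x \<bullet> (?B *\<^sub>v x) = x \<bullet> ((?A + ?B) *\<^sub>v x)"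
    using A B x by (simp add: add_mult_distrib_mat_vec[OF A B x] scalar_prod_add_distrib[of _ n])
  \<comment> \<open>This is \<open>(J - I) x\<close>: \<open>J\<close> turns \<open>x\<close> into
    the constant vector of its coordinate sum.\<close>
  also have "(?A + ?B) *\<^sub>v x = vec n (\<lambda>i. (\<Sum>j<n. x $ j) - x $ i)"
  proof (rule eq_vecI)
    fix i assume "i < dim_vec (vec n (\<lambda>i. (\<Sum>j<n. x $ j) - x $ i))"
    then have i: "i < n"
      by simp
    have "((?A + ?B) *\<^sub>v x) $ i = (\<Sum>j<n. (if i = j then 0 else 1) * x $ j)"
      using i x unfolding adjacency_mat_add_complement[OF G] n[symmetric]
      by (simp add: scalar_prod_def lessThan_atLeast0)
    also have "\<dots> = (\<Sum>j<n. x $ j - (if j = i then x $ j else 0))"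
      by (intro sum.cong) auto
    also have "\<dots> = (\<Sum>j<n. x $ j) - x $ i"
      using i by (simp add: sum_subtractf)
    finally show "((?A + ?B) *\<^sub>v x) $ i = vec n (\<lambda>i. (\<Sum>j<n. x $ j) - x $ i) $ i"
      using i by simp
  qed (use B in simp)
  also have "x \<bullet> vec n (\<lambda>i. (\<Sum>j<n. x $ j) - x $ i) = (\<Sum>i<n. x $ i)\<^sup>2 - x \<bullet> x"
    using x by (simp add: scalar_prod_def lessThan_atLeast0 right_diff_distrib sum_subtractf
        sum_distrib_right[symmetric] power2_eq_square)
  finally show ?thesis .
qed

theorem theorem7:
  fixes G :: "'a pair_pre_digraph" and n :: nat
  assumes "pair_graph G"
    and "n = card (pverts G)"
    and "n \<ge> 2"
  shows "1 \<le> n_pos G + n_pos (complement_graph G)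
       \<and> n_pos G + n_pos (complement_graph G) \<le> n + 1
       \<and> 0 \<le> n_zero G + n_zero (complement_graph G)
       \<and> n_zero G + n_zero (complement_graph G) \<le> n
       \<and> n - 1 \<le> n_neg G + n_neg (complement_graph G)"
proof -
  let ?H = "complement_graph G"
  let ?A = "adjacency_mat G" and ?B = "adjacency_mat ?H"
  interpret pair_graph G by (fact assms(1))
  have A: "?A \<in> carrier_mat n n" and B: "?B \<in> carrier_mat n n"
    using adjacency_mat_carrier[of G] adjacency_mat_carrier[of ?H] assms(2)
    by (simp_all add: complement_graph_def)
  note symA = transpose_adjacency_mat[OF assms(1)]
  note symB = transpose_adjacency_mat[OF pair_graph_complement_graph[OF assms(1)]]
  note form = adjacency_quadratic_form_add_complement[OF assms(1,2)]
  have triA: "n_pos G + n_zero G + n_neg G = n"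
    unfolding n_pos_def n_zero_def n_neg_def by (rule num_eigenvalues_trichotomy[OF A symA])
  have triB: "n_pos ?H + n_zero ?H + n_neg ?H = n"
    unfolding n_pos_def n_zero_def n_neg_def by (rule num_eigenvalues_trichotomy[OF B symB])
  let ?one = "vec n (\<lambda>_. 1 :: real)"
  have pos: "1 \<le> n_pos G + n_pos ?H"
  proof (rule ccontr)
    assume "\<not> 1 \<le> n_pos G + n_pos ?H"
    then have "num_eigenvalues (\<lambda>x. x > 0) ?A = 0" "num_eigenvalues (\<lambda>x. x > 0) ?B = 0"
      by (simp_all add: n_pos_def)
    then have "?one \<bullet> (?A *\<^sub>v ?one) + ?one \<bullet> (?B *\<^sub>v ?one) \<le> 0"
      by (intro add_nonpos_nonpos quadratic_form_nonpos[OF A symA] quadratic_form_nonpos[OF B symB]) auto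
    \<comment> \<open>The all-ones vector has coordinate sum \<open>n\<close> and squared norm
      \<open>n\<close>; the inequality fails for \<open>n \<ge> 2\<close>.\<close>
    then have "(real n)\<^sup>2 - real n \<le> 0"
      using form[of ?one] by (simp add: scalar_prod_def)
    then show False
      using assms(3) by (simp add: power2_eq_square)
  qed
  have neg: "n - 1 \<le> n_neg G + n_neg ?H"
  proof (rule ccontr)
    assume less: "\<not> n - 1 \<le> n_neg G + n_neg ?H"
    obtain fs where fs: "length fs = n_neg G" "set fs \<subseteq> carrier_vec n"
      "\<And>x. x \<in> carrier_vec n \<Longrightarrow> (\<And>f. f \<in> set fs \<Longrightarrow> f \<bullet> x = 0) \<Longrightarrow> 0 \<le> x \<bullet> (?A *\<^sub>v x)"
      using quadratic_form_nonneg_on_annihilator[OF A symA] unfolding n_neg_def by metis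
    obtain gs where gs: "length gs = n_neg ?H" "set gs \<subseteq> carrier_vec n"
      "\<And>x. x \<in> carrier_vec n \<Longrightarrow> (\<And>f. f \<in> set gs \<Longrightarrow> f \<bullet> x = 0) \<Longrightarrow> 0 \<le> x \<bullet> (?B *\<^sub>v x)"
      using quadratic_form_nonneg_on_annihilator[OF B symB] unfolding n_neg_def by metis
    \<comment> \<open>The all-ones vector costs one extra equation, which is why the bound is
      \<open>n - 1\<close> and not \<open>n\<close>.\<close>
    have "set (?one # fs @ gs) \<subseteq> carrier_vec n" "length (?one # fs @ gs) < n"
      using fs gs less by auto
    then obtain x where x: "x \<in> carrier_vec n" "x \<noteq> 0\<^sub>v n"
      and ann: "\<And>f. f \<in> set (?one # fs @ gs) \<Longrightarrow> f \<bullet> x = 0"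
      by (rule ex_nonzero_annihilated_vec) blast
    have "(\<Sum>i<n. x $ i) = 0"
      using ann[of ?one] x(1) by (simp add: scalar_prod_def lessThan_atLeast0)
    moreover have "0 \<le> x \<bullet> (?A *\<^sub>v x)" "0 \<le> x \<bullet> (?B *\<^sub>v x)"
      using fs(3)[OF x(1)] gs(3)[OF x(1)] ann by auto
    moreover have "0 < x \<bullet> x"
      using conjugate_square_greater_0_vec[OF x(1)] x(2) by simp
    ultimately show False
      using form[OF x(1)] by simp
  qed
  \<comment> \<open>All six counts add up to \<open>2 * n\<close>, so \<open>neg\<close> leaves at
    most \<open>n + 1\<close> for the positive and zero eigenvalues together. This bounds the
    positive ones, and by \<open>pos\<close> at most \<open>n\<close> remain for the zero
    ones.\<close>
  show ?thesis
    using pos neg triA triB assms(3) by linarith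
qed

end
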